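(* Let $\mathbf p\in\mathbb P(\mathcal X)$ and $\alpha\in[0,1)$, and let $\alpha_k$ and $\mathcal U_k$ be as in the context. If $k\in\{0,1,\dots,|\mathcal X|-1\}$ is such that $\alpha\in[\alpha_k,\alpha_{k+1})$, then the optimal real-valued prefix code length vector $\mathbf l^\dagger_\alpha$, minimizing $\mathbb L_\alpha(\mathbf l,\mathbf p)=\alpha\max_{x}l(x)+(1-\alpha)\sum_x l(x)p(x)$ over $\mathcal L(\mathbb R_+^{|\mathcal X|})$, is given by $$l^\dagger_\alpha(x)=\begin{cases}-\log\big((1-\alpha)p(x)\big), & x\in\mathcal U_k^c,\\[4pt] -\log\Big(\dfrac{\alpha+(1-\alpha)\sum_{y\in\mathcal U_k}p(y)}{|\mathcal U_k|}\Big), & x\in\mathcal U_k.\end{cases}$$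
   Context: Let $D\ge 2$ be an integer and $\log=\log_D$. Let $\mathcal X=\{x_1,\dots,x_{|\mathcal X|}\}$ be a finite alphabet and let $\mathbb P(\mathcal X)$ be the set of probability vectors $\mathbf p=(p(x_1),\dots,p(x_{|\mathcal X|}))$ with $p(x_1)\ge p(x_2)\ge\dots\ge p(x_{|\mathcal X|})>0$ and $\sum_x p(x)=1$. Real-valued prefix code length vectors are the elements of $\mathcal L(\mathbb R_+^{|\mathcal X|})=\{\mathbf l\in\mathbb R_+^{|\mathcal X|}:\sum_{x\in\mathcal X}D^{-l(x)}\le 1\}$, where $\mathbb R_+=[0,\infty)$. For $k\in\{0,\dots,|\mathcal X|-1\}$ let $\mathcal U_k=\{x_{|\mathcal X|-k},\dots,x_{|\mathcal X|}\}$ (so $|\mathcal U_k|=k+1$) and $\mathcal U_k^c=\mathcal X\setminus\mathcal U_k$. The numbers $\alpha_k$ are given by $\alpha_0=0$, the recursion $$\alpha_{k+1}=\alpha_k+(1-\alpha_k)\,\frac{p(x_{|\mathcal X|-(k+1)})-p(x_{|\mathcal X|-k})}{\dfrac{\sum_{y\in\mathcal U_k^c}p(y)}{|\mathcal U_k|}+p(x_{|\mathcal X|-(k+1)})},\qquad 0\le k\le|\mathcal X|-2,$$ and the convention $\alpha_{|\mathcal X|}=1$. They satisfy $0=\alpha_0\le\alpha_1\le\dots\le\alpha_{|\mathcal X|}=1$, and $[a,b)=\emptyset$ if $a=b$. *)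

theory Defs
  imports Complex_Main "HOL-Library.FuncSet"
begin

text \<open>The alphabet is a finite set \<open>X\<close> together with an enumeration \<open>x\<close> of its letters, which
  is a bijection from \<open>{1..card X}\<close> onto \<open>X\<close>.\<close>

definition prob_vectors :: "'a set \<Rightarrow> (nat \<Rightarrow> 'a) \<Rightarrow> ('a \<Rightarrow> real) set" where
  "prob_vectors X x =
     {p. (\<forall>i j. 1 \<le> i \<and> i \<le> j \<and> j \<le> card X \<longrightarrow> p (x j) \<le> p (x i))
       \<and> (\<forall>y\<in>X. p y > 0)
       \<and> (\<Sum>y\<in>X. p y) = 1}"

text \<open>A vector indexed by \<open>X\<close> is an extensional function on \<open>X\<close>, so that equality of vectors
  is equality of functions.\<close>

definition prefix_lengths :: "nat \<Rightarrow> 'a set \<Rightarrow> ('a \<Rightarrow> real) set" where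
  "prefix_lengths D X = {l \<in> X \<rightarrow>\<^sub>E {0..}. (\<Sum>y\<in>X. real D powr (- l y)) \<le> 1}"

definition pay_off :: "real \<Rightarrow> 'a set \<Rightarrow> ('a \<Rightarrow> real) \<Rightarrow> ('a \<Rightarrow> real) \<Rightarrow> real" where
  "pay_off \<alpha> X p l = \<alpha> * Max (l ` X) + (1 - \<alpha>) * (\<Sum>y\<in>X. l y * p y)"

definition least_likely :: "'a set \<Rightarrow> (nat \<Rightarrow> 'a) \<Rightarrow> nat \<Rightarrow> 'a set" where
  "least_likely X x k = x ` {card X - k..card X}"

text \<open>The recursion applies to indices \<open>Suc k < card X\<close>; at \<open>card X\<close> the value is \<open>1\<close> by
  convention. Values at indices beyond \<open>card X\<close> are irrelevant.\<close>

primrec alpha_seq :: "'a set \<Rightarrow> (nat \<Rightarrow> 'a) \<Rightarrow> ('a \<Rightarrow> real) \<Rightarrow> nat \<Rightarrow> real" where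
  "alpha_seq X x p 0 = 0"
| "alpha_seq X x p (Suc k) =
     (if Suc k < card X
      then alpha_seq X x p k + (1 - alpha_seq X x p k) *
             ((p (x (card X - Suc k)) - p (x (card X - k))) /
              ((\<Sum>y\<in>X - least_likely X x k. p y) / real (card (least_likely X x k))
                 + p (x (card X - Suc k))))
      else 1)"

end

theory Submission
  imports Defs
begin

text \<open>The closed form \<open>1 - \<alpha>\<^sub>k = 1 / T\<^sub>k\<close>, where \<open>T\<^sub>k\<close> is the mass of the complement of \<open>U\<^sub>k\<close> plus
  \<open>|U\<^sub>k|\<close> times the largest probability in \<open>U\<^sub>k\<close>, shows that \<open>\<alpha>\<^sub>k \<le> \<alpha> < \<alpha>\<^sub>k\<^sub>+\<^sub>1\<close> means that
  levelling the weights \<open>(1 - \<alpha>) p\<close> on \<open>U\<^sub>k\<close> to the constant \<open>c\<close> that makes the total mass \<open>1\<close>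
  raises the weights inside \<open>U\<^sub>k\<close> and leaves \<open>c\<close> below all weights outside. For the resulting
  probability vector \<open>q\<close>, the excess \<open>q - (1 - \<alpha>) p \<ge> 0\<close> has total mass \<open>\<alpha>\<close>, so the pay-off
  of \<open>l\<close> is at least \<open>\<Sum> q l\<close>, with equality when \<open>l\<close> is maximal wherever the excess is positive.
  Gibbs' inequality makes \<open>- log q\<close> the unique minimizer of \<open>\<Sum> q l\<close>.\<close>

section \<open>Gibbs' inequality and its equality case\<close>

lemma gibbs_pointwise:
  fixes a b :: real
  assumes "a > 0" "b > 0"
  shows "a * ln b - a * ln a \<le> b - a"
proof -
  have "a * ln (b / a) \<le> a * (b / a - 1)"
    using assms by (intro mult_left_mono ln_le_minus_one) auto
  then show ?thesis using assms by (simp add: ln_div algebra_simps)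
qed

text \<open>The pointwise bound is summed over \<open>X\<close>. The mass of \<open>r\<close> may
  fall short of that of \<open>q\<close>, so that every \<open>r\<close> coming from a length vector
  by the Kraft inequality is covered.\<close>

lemma gibbs_inequality:
  fixes q r :: "'a \<Rightarrow> real"
  assumes "\<And>y. y \<in> X \<Longrightarrow> q y > 0" "\<And>y. y \<in> X \<Longrightarrow> r y > 0" "sum r X \<le> sum q X"
  shows "(\<Sum>y\<in>X. q y * ln (r y)) \<le> (\<Sum>y\<in>X. q y * ln (q y))"
proof -
  have "q y * ln (r y) - q y * ln (q y) \<le> r y - q y" if "y \<in> X" for y
    using gibbs_pointwise[OF assms(1,2)] that by simp
  then have "(\<Sum>y\<in>X. q y * ln (r y) - q y * ln (q y)) \<le> (\<Sum>y\<in>X. r y - q y)"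
    by (rule sum_mono)
  then show ?thesis using assms(3) by (simp add: sum_subtractf)
qed

text \<open>Equality of the sums makes the total of the nonnegative pointwise gaps vanish, hence
  each gap. A zero gap reads \<open>ln t = t - 1\<close> for \<open>t = r z / q z\<close>, which
  forces \<open>t = 1\<close>.\<close>

lemma gibbs_equality:
  fixes q r :: "'a \<Rightarrow> real"
  assumes "finite X" "\<And>y. y \<in> X \<Longrightarrow> q y > 0" "\<And>y. y \<in> X \<Longrightarrow> r y > 0" "sum r X \<le> sum q X"
    and ge: "(\<Sum>y\<in>X. q y * ln (q y)) \<le> (\<Sum>y\<in>X. q y * ln (r y))"
    and z: "z \<in> X"
  shows "r z = q z"
proof -
  have nonneg: "0 \<le> (r y - q y) - (q y * ln (r y) - q y * ln (q y))" if "y \<in> X" for y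
    using gibbs_pointwise[OF assms(2,3)] that by simp
  have "(\<Sum>y\<in>X. (r y - q y) - (q y * ln (r y) - q y * ln (q y))) = 0"
    using assms(4) ge by (intro antisym sum_nonneg nonneg) (simp_all add: sum_subtractf)
  then have eq: "(r z - q z) - (q z * ln (r z) - q z * ln (q z)) = 0"
    using sum_nonneg_eq_0_iff[OF assms(1), of "\<lambda>y. (r y - q y) - (q y * ln (r y) - q y * ln (q y))"]
      nonneg z by auto
  have pos: "q z > 0" "r z > 0" using assms by auto
  have "ln (r z / q z) = r z / q z - 1"
    using eq pos by (simp add: ln_div field_simps)
  then have "r z / q z = 1"
    using pos by (intro ln_eq_minus_one) auto
  then show ?thesis using pos by simp
qed

section \<open>From the pay-off to a weighted mean length, and its minimizer\<close>

lemma pay_off_ge: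
  assumes "finite X" "\<And>y. y \<in> X \<Longrightarrow> (1 - \<alpha>) * p y \<le> q y"
    and "(\<Sum>y\<in>X. q y - (1 - \<alpha>) * p y) = \<alpha>"
  shows "(\<Sum>y\<in>X. q y * l y) \<le> pay_off \<alpha> X p l"
proof -
  \<comment> \<open>As the excess has mass \<alpha>, it distributes the term of the maximal length
    over the letters; each share is bounded below by using the letter's own length.\<close>
  have "(\<Sum>y\<in>X. (q y - (1 - \<alpha>) * p y) * l y) \<le> (\<Sum>y\<in>X. (q y - (1 - \<alpha>) * p y) * Max (l ` X))"
    using assms(1,2) by (intro sum_mono mult_left_mono) auto
  also have "\<dots> = \<alpha> * Max (l ` X)"
    by (simp only: sum_distrib_right[symmetric] assms(3))
  finally show ?thesis
    by (simp add: pay_off_def algebra_simps sum_subtractf sum.distrib sum_distrib_left)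
qed

text \<open>The lower bound loses only by replacing the maximum by \<open>l y\<close>, with the
  excess at \<open>y\<close> as factor. Nothing is lost if \<open>l y\<close> is the maximum
  wherever that factor is nonzero.\<close>

lemma pay_off_eq:
  assumes "finite X"
    and "\<And>y z. \<lbrakk>y \<in> X; z \<in> X; q y \<noteq> (1 - \<alpha>) * p y\<rbrakk> \<Longrightarrow> l z \<le> l y"
    and "(\<Sum>y\<in>X. q y - (1 - \<alpha>) * p y) = \<alpha>"
  shows "pay_off \<alpha> X p l = (\<Sum>y\<in>X. q y * l y)"
proof -
  have "(q y - (1 - \<alpha>) * p y) * l y = (q y - (1 - \<alpha>) * p y) * Max (l ` X)" if "y \<in> X" for y
  proof (cases "q y = (1 - \<alpha>) * p y")
    case False
    then have "Max (l ` X) = l y"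
      using assms(1,2) that by (intro Max_eqI) auto
    then show ?thesis by simp
  qed simp
  then have "(\<Sum>y\<in>X. (q y - (1 - \<alpha>) * p y) * l y) = (\<Sum>y\<in>X. (q y - (1 - \<alpha>) * p y) * Max (l ` X))"
    by (rule sum.cong[OF refl])
  also have "\<dots> = \<alpha> * Max (l ` X)"
    by (simp only: sum_distrib_right[symmetric] assms(3))
  finally show ?thesis
    by (simp add: pay_off_def algebra_simps sum_subtractf sum.distrib sum_distrib_left)
qed

text \<open>This optimality criterion isolates the analysis from the choice of \<open>q\<close>. The
  assumption \<open>level\<close> makes \<open>- log D (q y)\<close> maximal wherever the excess is
  nonzero.\<close>

lemma arg_min_pay_off:
  fixes q :: "'a \<Rightarrow> real"
  assumes D: "D \<ge> 2" and X: "finite X"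
    and q_pos: "\<And>y. y \<in> X \<Longrightarrow> q y > 0" and q_sum: "sum q X = 1"
    and ge: "\<And>y. y \<in> X \<Longrightarrow> (1 - \<alpha>) * p y \<le> q y"
    and excess: "(\<Sum>y\<in>X. q y - (1 - \<alpha>) * p y) = \<alpha>"
    and level: "\<And>y z. \<lbrakk>y \<in> X; z \<in> X; q y \<noteq> (1 - \<alpha>) * p y\<rbrakk> \<Longrightarrow> q y \<le> q z"
  shows "{l. is_arg_min (pay_off \<alpha> X p) (\<lambda>l. l \<in> prefix_lengths D X) l} =
    {\<lambda>y\<in>X. - log D (q y)}"
proof -
  define m where "m = (\<lambda>y\<in>X. - log D (q y))"
  have lnD: "ln (real D) > 0" using D by simp
  \<comment> \<open>This gives nonnegative lengths.\<close>
  have q_le: "q y \<le> 1" if "y \<in> X" for y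
    using member_le_sum[OF that _ X, of q] q_pos q_sum by (simp add: less_imp_le)
  have m_powr: "real D powr (- m y) = q y" if "y \<in> X" for y
    using that D q_pos by (simp add: m_def)
  have m_feasible: "m \<in> prefix_lengths D X"
  proof -
    have "log D (q y) \<le> 0" if "y \<in> X" for y
      using that D q_pos q_le by simp
    then have "m \<in> X \<rightarrow>\<^sub>E {0..}" by (auto simp: m_def)
    then show ?thesis
      using m_powr q_sum by (simp add: prefix_lengths_def)
  qed
  have m_value: "pay_off \<alpha> X p m = (\<Sum>y\<in>X. q y * m y)"
  proof (rule pay_off_eq[OF X _ excess])
    fix y z assume yz: "y \<in> X" "z \<in> X" "q y \<noteq> (1 - \<alpha>) * p y"
    then have "log D (q y) \<le> log D (q z)"
      using level q_pos D by simp
    then show "m z \<le> m y" using yz by (simp add: m_def)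
  qed
  \<comment> \<open>Gibbs' inequality is applied to \<open>r y = real D powr (- l y)\<close>. The
    negative factor turns its upper bound into a lower bound on the mean length.\<close>
  have scaled: "(\<Sum>y\<in>X. q y * ln (real D powr (- l y))) = - ln (real D) * (\<Sum>y\<in>X. q y * l y)" for l
    using D by (simp add: sum_distrib_left mult_ac sum_negf)
  have m_scaled: "(\<Sum>y\<in>X. q y * ln (q y)) = - ln (real D) * (\<Sum>y\<in>X. q y * m y)"
    using scaled[of m] by (simp add: m_powr)
  have l_sum: "(\<Sum>y\<in>X. real D powr (- l y)) \<le> sum q X" if "l \<in> prefix_lengths D X" for l
    using that q_sum by (simp add: prefix_lengths_def)
  have min: "pay_off \<alpha> X p m \<le> pay_off \<alpha> X p l" if l: "l \<in> prefix_lengths D X" for l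
  proof -
    have "(\<Sum>y\<in>X. q y * ln (real D powr (- l y))) \<le> (\<Sum>y\<in>X. q y * ln (q y))"
      using q_pos D l_sum[OF l] by (intro gibbs_inequality) auto
    then have "(\<Sum>y\<in>X. q y * m y) \<le> (\<Sum>y\<in>X. q y * l y)"
      unfolding scaled m_scaled using lnD by simp
    also have "\<dots> \<le> pay_off \<alpha> X p l" by (rule pay_off_ge[OF X ge excess])
    finally show ?thesis by (simp add: m_value)
  qed
  have unique: "l = m" if l: "l \<in> prefix_lengths D X" and le: "pay_off \<alpha> X p l \<le> pay_off \<alpha> X p m" for l
  proof (rule extensionalityI)
    show "l \<in> extensional X" "m \<in> extensional X"
      using l m_feasible by (auto simp: prefix_lengths_def PiE_def)
    fix z assume z: "z \<in> X"
    \<comment> \<open>The mean length of \<open>l\<close> is squeezed below that of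
      \<open>m\<close>, which is the equality case of Gibbs' inequality.\<close>
    have "(\<Sum>y\<in>X. q y * l y) \<le> pay_off \<alpha> X p l"
      by (rule pay_off_ge[OF X ge excess])
    also have "\<dots> \<le> (\<Sum>y\<in>X. q y * m y)" using le m_value by simp
    finally have "(\<Sum>y\<in>X. q y * ln (q y)) \<le> (\<Sum>y\<in>X. q y * ln (real D powr (- l y)))"
      unfolding scaled m_scaled using lnD by simp
    then have "real D powr (- l z) = q z"
      using X q_pos D l_sum[OF l] z by (intro gibbs_equality[where X = X]) auto
    then have "real D powr (- l z) = real D powr (- m z)" by (simp add: m_powr z)
    then show "l z = m z" using D by (simp add: powr_inj)
  qed
  show ?thesis
    unfolding m_def[symmetric] is_arg_min_def
    using m_feasible min unique by (auto simp: not_less)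
qed

section \<open>The least likely letters and the thresholds\<close>

lemma least_likely_subset:
  assumes "bij_betw x {1..card X} X" "k < card X"
  shows "least_likely X x k \<subseteq> X"
  using bij_betw_imp_surj_on[OF assms(1)] assms(2) by (force simp: least_likely_def)

lemma card_least_likely:
  assumes "bij_betw x {1..card X} X" "k < card X"
  shows "card (least_likely X x k) = Suc k"
proof -
  have "inj_on x {card X - k..card X}"
    using assms by (intro inj_on_subset[OF bij_betw_imp_inj_on[OF assms(1)]]) auto
  then show ?thesis
    using assms(2) by (simp add: least_likely_def card_image)
qed

lemma sum_complement_least_likely:
  fixes p :: "'a \<Rightarrow> real"
  assumes "finite X" "bij_betw x {1..card X} X" "Suc k < card X"
  shows "sum p (X - least_likely X x k) =
    p (x (card X - Suc k)) + sum p (X - least_likely X x (Suc k))"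
proof -
  let ?z = "x (card X - Suc k)"
  have inj: "inj_on x {1..card X}" using assms(2) by (rule bij_betw_imp_inj_on)
  have "{card X - Suc k..card X} = insert (card X - Suc k) {card X - k..card X}"
    using assms(3) by auto
  then have U: "least_likely X x (Suc k) = insert ?z (least_likely X x k)"
    by (simp add: least_likely_def)
  have "?z \<notin> least_likely X x k"
    using assms(3) inj_onD[OF inj, of "card X - Suc k"] by (force simp: least_likely_def)
  moreover have "?z \<in> X"
    using assms(3) bij_betwE[OF assms(2)] by auto
  ultimately have "X - least_likely X x k = insert ?z (X - least_likely X x (Suc k))"
    unfolding U by auto
  moreover have "?z \<notin> X - least_likely X x (Suc k)" by (simp add: U)
  ultimately show ?thesis using assms(1) by (metis finite_Diff sum.insert)
qed

lemma prob_vectors_pos: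
  assumes "bij_betw x {1..card X} X" "p \<in> prob_vectors X x" "k < card X"
  shows "p (x (card X - k)) > 0"
  using assms bij_betwE[OF assms(1)] by (auto simp: prob_vectors_def)

text \<open>The recursion multiplies \<open>1 - alpha_seq X x p k\<close> by a quotient of
  consecutive denominators, so the product telescopes.\<close>

lemma alpha_seq_closed_form:
  assumes "finite X" "bij_betw x {1..card X} X" "p \<in> prob_vectors X x" "k < card X"
  shows "1 - alpha_seq X x p k =
    1 / (sum p (X - least_likely X x k) + real (Suc k) * p (x (card X - k)))"
  using assms(4)
proof (induction k)
  case 0
  have "x (card X) \<in> X" using 0 bij_betwE[OF assms(2)] by auto
  moreover have "sum p X = 1" using assms(3) by (simp add: prob_vectors_def)
  ultimately show ?case
    using sum.remove[OF assms(1), of "x (card X)" p] by (simp add: least_likely_def)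
next
  case (Suc k)
  let ?a = "p (x (card X - k))" and ?b = "p (x (card X - Suc k))"
  define S where "S = sum p (X - least_likely X x k)"
  have pos: "?a > 0" "?b > 0"
    using prob_vectors_pos[OF assms(2,3)] Suc.prems by auto
  have "S \<ge> 0"
    using assms(3) unfolding S_def by (intro sum_nonneg) (auto simp: prob_vectors_def less_imp_le)
  then have den: "S + real (Suc k) * ?a > 0" "S + real (Suc k) * ?b > 0"
    using pos by (auto intro!: add_nonneg_pos)
  have den': "S / real (Suc k) + ?b = (S + real (Suc k) * ?b) / real (Suc k)"
    by (simp add: field_simps)
  have card: "card (least_likely X x k) = Suc k"
    using card_least_likely[OF assms(2)] Suc.prems by simp
  have "1 - alpha_seq X x p (Suc k) =
      (1 - alpha_seq X x p k) * (1 - (?b - ?a) / (S / real (Suc k) + ?b))"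
    using Suc.prems by (simp add: card S_def algebra_simps)
  \<comment> \<open>The new denominator is written with the old complement: \<open>S\<close> still
    contains one copy of \<open>?b\<close>, which later joins the \<open>Suc k\<close>
    others.\<close>
  also have "1 - (?b - ?a) / (S / real (Suc k) + ?b) =
      (S + real (Suc k) * ?a) / (S + real (Suc k) * ?b)"
    unfolding den' using den(2) by (simp add: divide_simps) (simp add: algebra_simps)
  also have "1 - alpha_seq X x p k = 1 / (S + real (Suc k) * ?a)"
    using Suc.IH Suc.prems by (simp add: S_def)
  also have "1 / (S + real (Suc k) * ?a) * ((S + real (Suc k) * ?a) / (S + real (Suc k) * ?b)) =
      1 / (S + real (Suc k) * ?b)"
    using den(1) by simp
  also have "S = ?b + sum p (X - least_likely X x (Suc k))"
    unfolding S_def using assms Suc.prems by (intro sum_complement_least_likely)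
  finally show ?case by (simp add: algebra_simps)
qed

section \<open>Levelled weights and the optimal lengths\<close>

theorem theorem2:
  fixes D :: nat and X :: "'a set" and x :: "nat \<Rightarrow> 'a" and p :: "'a \<Rightarrow> real"
    and \<alpha> :: real and k :: nat
  assumes "D \<ge> 2"
    and "finite X"
    and "bij_betw x {1..card X} X"
    and "p \<in> prob_vectors X x"
    and "\<alpha> \<in> {0..<1}"
    and "k < card X"
    and "\<alpha> \<in> {alpha_seq X x p k..<alpha_seq X x p (k + 1)}"
  shows "{l. is_arg_min (pay_off \<alpha> X p) (\<lambda>l. l \<in> prefix_lengths D X) l} =
    {\<lambda>y\<in>X. if y \<in> X - least_likely X x k
            then - log D ((1 - \<alpha>) * p y)
            else - log D ((\<alpha> + (1 - \<alpha>) * (\<Sum>z\<in>least_likely X x k. p z))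
                            / real (card (least_likely X x k)))}"
proof -
  let ?n = "card X"
  define U where "U = least_likely X x k"
  define c where "c = (\<alpha> + (1 - \<alpha>) * sum p U) / real (card U)"
  define q where "q = (\<lambda>y. if y \<in> X - U then (1 - \<alpha>) * p y else c)"
  have \<alpha>: "0 \<le> \<alpha>" "\<alpha> < 1" using assms(5) by auto
  have p_pos: "p y > 0" if "y \<in> X" for y
    using assms(4) that by (simp add: prob_vectors_def)
  have p_sum: "sum p X = 1" using assms(4) by (simp add: prob_vectors_def)
  have p_mono: "p (x j) \<le> p (x i)" if "1 \<le> i" "i \<le> j" "j \<le> ?n" for i j
    using assms(4) that by (simp add: prob_vectors_def)
  have U_sub: "U \<subseteq> X"
    unfolding U_def using assms(3,6) by (rule least_likely_subset)
  have U_card: "card U = Suc k"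
    unfolding U_def using assms(3,6) by (rule card_least_likely)
  have split: "sum f X = sum f (X - U) + sum f U" for f :: "'a \<Rightarrow> real"
    using sum.subset_diff[OF U_sub assms(2)] .
  have c_card: "real (Suc k) * c = \<alpha> + (1 - \<alpha>) * sum p U"
    by (simp add: c_def U_card)
  moreover have "sum p U = 1 - sum p (X - U)"
    using split[of p] p_sum by simp
  \<comment> \<open>In this form \<open>c\<close> involves the same complement sum as the closed
    form of the thresholds, so both comparisons below reduce to bounds on that sum.\<close>
  ultimately have c_card': "real (Suc k) * c = 1 - (1 - \<alpha>) * sum p (X - U)"
    by (simp add: algebra_simps)
  have rest_nonneg: "0 \<le> sum p (X - U)"
    using p_pos by (intro sum_nonneg) (auto simp: less_imp_le)
  have c_pos: "c > 0"
  proof -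
    have "sum p U > 0"
      using U_sub U_card p_pos finite_subset[OF U_sub assms(2)] by (intro sum_pos) auto
    then show ?thesis
      unfolding c_def U_card using \<alpha>
      by (intro divide_pos_pos add_nonneg_pos mult_pos_pos) auto
  qed
  \<comment> \<open>The lower threshold settles the letter \<open>x (?n - k)\<close>, the most
    likely one in \<open>U\<close>; monotonicity settles the others.\<close>
  have below: "(1 - \<alpha>) * p y \<le> c" if y: "y \<in> U" for y
  proof -
    have pos: "sum p (X - U) + real (Suc k) * p (x (?n - k)) > 0"
      using prob_vectors_pos[OF assms(3,4,6)] rest_nonneg by (intro add_nonneg_pos) auto
    have "1 - \<alpha> \<le> 1 / (sum p (X - U) + real (Suc k) * p (x (?n - k)))"
      using assms(7) alpha_seq_closed_form[OF assms(2,3,4,6)] by (simp add: U_def)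
    then have "(1 - \<alpha>) * (sum p (X - U) + real (Suc k) * p (x (?n - k))) \<le> 1"
      using pos by (simp add: pos_le_divide_eq)
    then have "real (Suc k) * ((1 - \<alpha>) * p (x (?n - k))) \<le> real (Suc k) * c"
      unfolding c_card' by (simp add: algebra_simps)
    then have "(1 - \<alpha>) * p (x (?n - k)) \<le> c"
      by (rule mult_left_le_imp_le) simp
    moreover obtain j where "y = x j" "?n - k \<le> j" "j \<le> ?n"
      using y by (auto simp: U_def least_likely_def)
    then have "p y \<le> p (x (?n - k))" using p_mono assms(6) by simp
    then have "(1 - \<alpha>) * p y \<le> (1 - \<alpha>) * p (x (?n - k))"
      using \<alpha> by (intro mult_left_mono) auto
    ultimately show ?thesis by simp
  qed
  have above: "c \<le> (1 - \<alpha>) * p y" if y: "y \<in> X - U" for y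
  proof -
    obtain i where i: "y = x i" "1 \<le> i" "i \<le> ?n"
      using y bij_betw_imp_surj_on[OF assms(3)] by force
    then have i_less: "i < ?n - k"
      using y by (force simp: U_def least_likely_def)
    \<comment> \<open>A letter outside \<open>U\<close> exists only if \<open>Suc k < ?n\<close>, so
      the conventional value at \<open>card X\<close> does not arise and the closed form applies at
      \<open>Suc k\<close>. The letter \<open>x (?n - Suc k)\<close> is the least likely one outside
      \<open>U\<close>.\<close>
    then have k: "Suc k < ?n" using i(2) by simp
    let ?b = "p (x (?n - Suc k))"
    have pos: "sum p (X - U) + real (Suc k) * ?b > 0"
      using prob_vectors_pos[OF assms(3,4) k] rest_nonneg by (intro add_nonneg_pos) auto
    have rest: "sum p (X - U) = ?b + sum p (X - least_likely X x (Suc k))"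
      unfolding U_def using assms(2,3) k by (rule sum_complement_least_likely)
    have "sum p (X - least_likely X x (Suc k)) + real (Suc (Suc k)) * ?b =
        sum p (X - U) + real (Suc k) * ?b"
      unfolding rest by (simp add: algebra_simps)
    then have "1 / (sum p (X - U) + real (Suc k) * ?b) < 1 - \<alpha>"
      using assms(7) alpha_seq_closed_form[OF assms(2,3,4) k] by simp
    then have "1 < (1 - \<alpha>) * (sum p (X - U) + real (Suc k) * ?b)"
      using pos by (simp add: pos_divide_less_eq)
    then have "real (Suc k) * c \<le> real (Suc k) * ((1 - \<alpha>) * ?b)"
      unfolding c_card' by (simp add: algebra_simps)
    then have "c \<le> (1 - \<alpha>) * ?b"
      by (rule mult_left_le_imp_le) simp
    also have "?b \<le> p y" unfolding i(1) using i i_less by (intro p_mono) auto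
    then have "(1 - \<alpha>) * ?b \<le> (1 - \<alpha>) * p y"
      using \<alpha> by (intro mult_left_mono) auto
    finally show ?thesis .
  qed
  have q_sum: "sum q X = 1"
  proof -
    have "sum q X = (\<Sum>y\<in>X - U. (1 - \<alpha>) * p y) + (\<Sum>y\<in>U. c)"
      unfolding split by (simp add: q_def)
    also have "\<dots> = (1 - \<alpha>) * sum p (X - U) + real (Suc k) * c"
      by (simp only: sum_distrib_left sum_constant U_card)
    finally show ?thesis by (simp only: c_card')
  qed
  have "{l. is_arg_min (pay_off \<alpha> X p) (\<lambda>l. l \<in> prefix_lengths D X) l} = {\<lambda>y\<in>X. - log D (q y)}"
  proof (rule arg_min_pay_off[OF assms(1,2)])
    show "sum q X = 1" by (rule q_sum)
    show "(\<Sum>y\<in>X. q y - (1 - \<alpha>) * p y) = \<alpha>"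
      by (simp add: sum_subtractf q_sum sum_distrib_left[symmetric] p_sum)
    show "q y > 0" if "y \<in> X" for y
      using \<alpha> c_pos p_pos that by (simp add: q_def)
    show "(1 - \<alpha>) * p y \<le> q y" if "y \<in> X" for y
      using below that by (simp add: q_def)
    \<comment> \<open>The excess can be nonzero only on \<open>U\<close>, where \<open>q\<close>
      equals \<open>c\<close>, its minimum by \<open>above\<close>.\<close>
    show "q y \<le> q z" if "y \<in> X" "z \<in> X" "q y \<noteq> (1 - \<alpha>) * p y" for y z
      using above that by (auto simp: q_def split: if_splits)
  qed
  also have "(\<lambda>y\<in>X. - log D (q y)) = (\<lambda>y\<in>X. if y \<in> X - U then - log D ((1 - \<alpha>) * p y) else - log D c)"
    by (auto simp: q_def)
  finally show ?thesis by (simp only: U_def c_def)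
qed

end
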